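(* Consider the problem $\min_{x\in\mathbb{R}^n}F(x)$ with $F=(F_1,\dots,F_m)$, $F_i=f_i+g_i$, where each $f_i$ is continuously differentiable and $L_i$-smooth and each $g_i$ is proper, convex and lower semicontinuous. Assume that $\Omega=\{x\in\mathbb{R}^n:F(x)\preceq F(x^0)\}$ is a bounded set and that $f_i$ is convex for every $i\in[m]$. Let $\{x^k\}$ be the (infinite) sequence generated from $x^0$ by the adaptive Barzilai-Borwein proximal gradient method (ABBPGMO, described in the context) with parameter $\tau>1$, where $\alpha_{\min}$ is small enough that $\alpha_{\min}\le\min_{i\in[m]}L_i$. Then: (i) $\{x^k\}$ converges to some weakly Pareto solution $x^*$. (ii) $u_0^{\tau L}(x^k)\le\frac{R^2}{2k}$ for all $k\ge1$, where $R:=\max\{\|x-y\|:x,y\in\Omega\}$ and $u_0^{\tau L}(x)=\sup_{y\in\mathbb{R}^n}\min_{i\in[m]}\left\{\frac{F_i(x)-F_i(y)}{\tau L_i}\right\}$.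
   Context: Notation: $[m]=\{1,\dots,m\}$; for $u,v\in\mathbb{R}^m$, $u\preceq v$ means $u_i\le v_i$ for all $i$, and $u\prec v$ means $u_i<v_i$ for all $i$. $F:\mathbb{R}^n\to\mathbb{R}^m$. A point $x^*$ is a weakly Pareto solution if there is no $x$ with $F(x)\prec F(x^* )$. It is Pareto critical if $\max_{i\in[m]}F_i'(x^*;d)\ge0$ for all $d\in\mathbb{R}^n$, where $F_i'(x;d)$ is the directional derivative. A differentiable $h$ is $L$-smooth if $\|\nabla h(y)-\nabla h(x)\|\le L\|y-x\|$ for all $x,y$. ABBPGMO. Fix $\tau>1$ and constants $0<\alpha_{\min}<\alpha_{\max}$ ($\alpha_{\max}$ sufficiently large). Given $x^0$, choose $x^{-1}\ne x^0$ in a small neighborhood of $x^0$. For $\alpha\in\mathbb{R}^m$ with positive entries, let $P_\alpha(x^k)$ be the unique minimizer over $x\in\mathbb{R}^n$ of $\max_{i\in[m]}\left\{\frac{\langle\nabla f_i(x^k),x-x^k\rangle+g_i(x)-g_i(x^k)}{\alpha_i}+\frac12\|x-x^k\|^2\right\}$. For $k=0,1,2,\dots$: 1. With $s^{k-1}=x^k-x^{k-1}$ and $y_i^{k-1}=\nabla f_i(x^k)-\nabla f_i(x^{k-1})$, initialize for each $i\in[m]$: $\alpha_i^k=\max\{\alpha_{\min},\min\{\langle s^{k-1},y_i^{k-1}\rangle/\langle s^{k-1},s^{k-1}\rangle,\alpha_{\max}\}\}$ if $\langle s^{k-1},y_i^{k-1}\rangle>0$; $\alpha_i^k=\max\{\alpha_{\min},\min\{\|y_i^{k-1}\|/\|s^{k-1}\|,\alpha_{\max}\}\}$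 if $\langle s^{k-1},y_i^{k-1}\rangle<0$; $\alpha_i^k=\alpha_{\min}$ if $\langle s^{k-1},y_i^{k-1}\rangle=0$. 2. Set $x^{k+1}=P_{\alpha^k}(x^k)$; stop if $x^{k+1}=x^k$. 3. Repeat: for every $i$ with $f_i(x^{k+1})-f_i(x^k)>\langle\nabla f_i(x^k),x^{k+1}-x^k\rangle+\frac{\alpha_i^k}{2}\|x^{k+1}-x^k\|^2$ replace $\alpha_i^k$ by $\tau\alpha_i^k$; then recompute $x^{k+1}=P_{\alpha^k}(x^k)$; until $f_i(x^{k+1})-f_i(x^k)\le\langle\nabla f_i(x^k),x^{k+1}-x^k\rangle+\frac{\alpha_i^k}{2}\|x^{k+1}-x^k\|^2$ for all $i\in[m]$. Standing assumption: the algorithm does not stop, i.e. it produces an infinite sequence of points that are not Pareto critical. *)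

theory Defs
  imports "HOL-Analysis.Analysis" "HOL-Library.While_Combinator"
begin

text \<open>
  The nonsmooth parts of the objectives are functions into \<^typ>\<open>ereal\<close>, so that being proper and
  lower semicontinuous are real hypotheses; a finite-valued objective is the special case
  where \<^term>\<open>\<infinity>\<close> is not attained. The objectives are indexed by a finite type, and a
  vector-valued function is an indexed family of its components.
\<close>

definition proper_fun :: "('a \<Rightarrow> ereal) \<Rightarrow> bool" where
  "proper_fun h \<longleftrightarrow> (\<exists>x. h x < \<infinity>) \<and> (\<forall>x. h x > -\<infinity>)"

definition convex_fun :: "('a::real_vector \<Rightarrow> ereal) \<Rightarrow> bool" where
  "convex_fun h \<longleftrightarrow> (\<forall>x y. \<forall>t\<in>{0..1}.
     h ((1 - t) *\<^sub>R x + t *\<^sub>R y) \<le> ereal (1 - t) * h x + ereal t * h y)"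

definition lsc_fun :: "('a::topological_space \<Rightarrow> ereal) \<Rightarrow> bool" where
  "lsc_fun h \<longleftrightarrow> (\<forall>x. h x \<le> Liminf (at x) h)"

definition grad :: "('a::real_inner \<Rightarrow> real) \<Rightarrow> 'a \<Rightarrow> 'a" where
  "grad h x = (THE D. GDERIV h x :> D)"

definition smooth_fun :: "real \<Rightarrow> ('a::real_inner \<Rightarrow> real) \<Rightarrow> bool" where
  "smooth_fun L h \<longleftrightarrow> (\<forall>x. h differentiable at x) \<and>
     (\<forall>x y. norm (grad h y - grad h x) \<le> L * norm (y - x))"

definition dir_deriv :: "('a::real_vector \<Rightarrow> ereal) \<Rightarrow> 'a \<Rightarrow> 'a \<Rightarrow> ereal" where
  "dir_deriv h x d = Lim (at_right 0) (\<lambda>t::real. (h (x + t *\<^sub>R d) - h x) / ereal t)"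

definition pareto_critical :: "('m::finite \<Rightarrow> 'a::real_vector \<Rightarrow> ereal) \<Rightarrow> 'a \<Rightarrow> bool" where
  "pareto_critical F x \<longleftrightarrow> (\<forall>d. (MAX i. dir_deriv (F i) x d) \<ge> 0)"

text \<open>
  With extended-valued objectives a solution has to lie in the common effective domain, that is,
  have a finite objective vector.
\<close>

definition weakly_pareto :: "('m::finite \<Rightarrow> 'a \<Rightarrow> ereal) \<Rightarrow> 'a \<Rightarrow> bool" where
  "weakly_pareto F x \<longleftrightarrow> (\<forall>i. F i x < \<infinity>) \<and> \<not> (\<exists>y. \<forall>i. F i y < F i x)"

definition merit :: "('m::finite \<Rightarrow> real) \<Rightarrow> ('m \<Rightarrow> 'a \<Rightarrow> ereal) \<Rightarrow> 'a \<Rightarrow> ereal" where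
  "merit a F x = (SUP y. MIN i. (F i x - F i y) / ereal (a i))"

definition prox_model ::
  "('m::finite \<Rightarrow> 'a::real_inner \<Rightarrow> real) \<Rightarrow> ('m \<Rightarrow> 'a \<Rightarrow> ereal) \<Rightarrow> ('m \<Rightarrow> real) \<Rightarrow> 'a \<Rightarrow> 'a \<Rightarrow> ereal" where
  "prox_model f g a x z = (MAX i.
     (ereal (grad (f i) x \<bullet> (z - x)) + g i z - g i x) / ereal (a i)
       + ereal (1 / 2 * (norm (z - x))\<^sup>2))"

definition prox_step ::
  "('m::finite \<Rightarrow> 'a::real_inner \<Rightarrow> real) \<Rightarrow> ('m \<Rightarrow> 'a \<Rightarrow> ereal) \<Rightarrow> ('m \<Rightarrow> real) \<Rightarrow> 'a \<Rightarrow> 'a" where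
  "prox_step f g a x = (THE z. is_arg_min (prox_model f g a x) (\<lambda>_. True) z)"

definition bb_init ::
  "('m \<Rightarrow> 'a::real_inner \<Rightarrow> real) \<Rightarrow> real \<Rightarrow> real \<Rightarrow> 'a \<Rightarrow> 'a \<Rightarrow> 'm \<Rightarrow> real" where
  "bb_init f \<alpha>min \<alpha>max xprev x i =
     (let s = x - xprev; y = grad (f i) x - grad (f i) xprev in
      if s \<bullet> y > 0 then max \<alpha>min (min ((s \<bullet> y) / (s \<bullet> s)) \<alpha>max)
      else if s \<bullet> y < 0 then max \<alpha>min (min (norm y / norm s) \<alpha>max)
      else \<alpha>min)"

definition descent_ok ::
  "('m \<Rightarrow> 'a::real_inner \<Rightarrow> real) \<Rightarrow> ('m \<Rightarrow> real) \<Rightarrow> 'a \<Rightarrow> 'a \<Rightarrow> 'm \<Rightarrow> bool" where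
  "descent_ok f a x z i \<longleftrightarrow>
     f i z - f i x \<le> grad (f i) x \<bullet> (z - x) + a i / 2 * (norm (z - x))\<^sup>2"

definition inflate ::
  "('m::finite \<Rightarrow> 'a::real_inner \<Rightarrow> real) \<Rightarrow> ('m \<Rightarrow> 'a \<Rightarrow> ereal) \<Rightarrow> real \<Rightarrow> 'a \<Rightarrow> ('m \<Rightarrow> real) \<Rightarrow> 'm \<Rightarrow> real" where
  "inflate f g \<tau> x a i = (if descent_ok f a x (prox_step f g a x) i then a i else \<tau> * a i)"

text \<open>
  The backtracking is a repeat-until loop, so its body is executed once before the first test.
  The value is \<^term>\<open>None\<close> if the loop does not terminate.
\<close>

definition backtrack ::
  "('m::finite \<Rightarrow> 'a::real_inner \<Rightarrow> real) \<Rightarrow> ('m \<Rightarrow> 'a \<Rightarrow> ereal) \<Rightarrow> real \<Rightarrow> 'a \<Rightarrow> ('m \<Rightarrow> real) \<Rightarrow> ('m \<Rightarrow> real) option" where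
  "backtrack f g \<tau> x a =
     while_option (\<lambda>a. \<not> (\<forall>i. descent_ok f a x (prox_step f g a x) i))
       (inflate f g \<tau> x) (inflate f g \<tau> x a)"

text \<open>
  \<open>xm1\<close> is the auxiliary starting point preceding \<^term>\<open>x 0\<close>. The run is infinite: the stopping
  test, performed on the step with the initial parameters, fails in every iteration.
\<close>

definition abbpgmo ::
  "('m::finite \<Rightarrow> 'a::real_inner \<Rightarrow> real) \<Rightarrow> ('m \<Rightarrow> 'a \<Rightarrow> ereal) \<Rightarrow> real \<Rightarrow> real \<Rightarrow> real \<Rightarrow> 'a \<Rightarrow> (nat \<Rightarrow> 'a) \<Rightarrow> bool" where
  "abbpgmo f g \<tau> \<alpha>min \<alpha>max xm1 x \<longleftrightarrow> xm1 \<noteq> x 0 \<and>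
     (\<forall>k. let a0 = bb_init f \<alpha>min \<alpha>max (case k of 0 \<Rightarrow> xm1 | Suc j \<Rightarrow> x j) (x k) in
        prox_step f g a0 (x k) \<noteq> x k \<and>
        (\<exists>a. backtrack f g \<tau> (x k) a0 = Some a \<and> x (Suc k) = prox_step f g a (x k)))"

end

theory Submission
  imports Defs
begin

text \<open>
  The maximum defining the proximal model is 1-strongly convex, so its minimizer \<open>p = x\<^sup>k\<^sup>+\<^sup>1\<close> satisfies
  a quadratic growth inequality. Testing it at \<open>z\<close>, bounding the model below at \<open>p\<close> by the descent
  condition and above at \<open>z\<close> by convexity of the \<open>f\<^sub>i\<close>, gives
  \<open>min\<^sub>i (F\<^sub>i p - F\<^sub>i z) / \<alpha>\<^sub>i \<le> 1/2 \<parallel>z - x\<^sup>k\<parallel>\<^sup>2 - 1/2 \<parallel>z - p\<parallel>\<^sup>2\<close>. Since backtracking keeps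
  \<open>\<alpha>\<^sub>i \<le> \<tau> L\<^sub>i\<close> and every \<open>F\<^sub>i\<close> decreases along the sequence, telescoping yields the rate. For a
  cluster point \<open>z\<close> the left-hand side is nonnegative, so the sequence is Fejer monotone with
  respect to \<open>z\<close> and converges; a point strictly dominating the limit would contradict the rate.
\<close>

section \<open>Gradients, the descent lemma and the gradient inequality\<close>

text \<open>A linear functional is the inner product with the vector of its values on the basis, and
  two representing vectors differ by a vector orthogonal to everything. So the definite description
  in \<open>grad\<close> denotes.\<close>

lemma GDERIV_grad:
  fixes h :: "'a::euclidean_space \<Rightarrow> real"
  assumes "h differentiable at x"
  shows "GDERIV h x :> grad h x"
proof -
  from assms obtain h' where h': "(h has_derivative h') (at x)"
    unfolding differentiable_def by blast
  have "h' v = v \<bullet> (\<Sum>b\<in>Basis. h' b *\<^sub>R b)" for v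
  proof -
    have lin: "linear h'" using h' by (rule has_derivative_linear)
    have "h' v = h' (\<Sum>b\<in>Basis. (v \<bullet> b) *\<^sub>R b)"
      by (simp add: euclidean_representation)
    also have "\<dots> = (\<Sum>b\<in>Basis. (v \<bullet> b) * h' b)"
      by (simp add: linear_sum[OF lin] linear_scale[OF lin])
    finally show ?thesis
      by (simp add: inner_sum_right mult.commute)
  qed
  then have "h' = (\<lambda>v. v \<bullet> (\<Sum>b\<in>Basis. h' b *\<^sub>R b))" by blast
  with h' have ex: "GDERIV h x :> (\<Sum>b\<in>Basis. h' b *\<^sub>R b)"
    unfolding gderiv_def by simp
  have uniq: "D = E" if "GDERIV h x :> D" "GDERIV h x :> E" for D E
  proof -
    have "(\<lambda>v. v \<bullet> D) = (\<lambda>v. v \<bullet> E)"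
      using that unfolding gderiv_def by (rule has_derivative_unique)
    then have "v \<bullet> (D - E) = 0" for v
      by (metis inner_diff_right right_minus_eq)
    then have "(D - E) \<bullet> (D - E) = 0" .
    then show ?thesis by simp
  qed
  show ?thesis
    unfolding grad_def by (rule theI[of _ "\<Sum>b\<in>Basis. h' b *\<^sub>R b"]) (use ex uniq in blast)+
qed

lemma has_real_derivative_along_line:
  fixes h :: "'a::euclidean_space \<Rightarrow> real"
  assumes "h differentiable at (x + t *\<^sub>R d)"
  shows "((\<lambda>s. h (x + s *\<^sub>R d)) has_real_derivative grad h (x + t *\<^sub>R d) \<bullet> d) (at t)"
proof -
  have "((\<lambda>s. x + s *\<^sub>R d) has_derivative (\<lambda>s. s *\<^sub>R d)) (at t)"
    by (auto intro!: derivative_eq_intros)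
  moreover have "(h has_derivative (\<lambda>v. v \<bullet> grad h (x + t *\<^sub>R d))) (at (x + t *\<^sub>R d))"
    using GDERIV_grad[OF assms] by (simp add: gderiv_def)
  ultimately have "((\<lambda>s. h (x + s *\<^sub>R d)) has_derivative (\<lambda>s. (s *\<^sub>R d) \<bullet> grad h (x + t *\<^sub>R d))) (at t)"
    by (rule has_derivative_compose)
  then show ?thesis
    by (simp add: has_field_derivative_def inner_commute mult.commute[of _ "_ \<bullet> _"])
qed

text \<open>The classical descent lemma. On the segment from \<open>x\<close> to \<open>z\<close>,
  the defect \<open>\<psi>\<close> has nonpositive derivative by Cauchy-Schwarz and the Lipschitz
  bound.\<close>

lemma smooth_fun_upper_bound:
  fixes h :: "'a::euclidean_space \<Rightarrow> real"
  assumes "smooth_fun K h"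
  shows "h z - h x \<le> grad h x \<bullet> (z - x) + K / 2 * (norm (z - x))\<^sup>2"
proof -
  define d where "d = z - x"
  have diff: "h differentiable at y" for y
    using assms by (simp add: smooth_fun_def)
  have lip: "norm (grad h y - grad h w) \<le> K * norm (y - w)" for y w
    using assms by (simp add: smooth_fun_def)
  define \<psi> where "\<psi> t = h (x + t *\<^sub>R d) - t * (grad h x \<bullet> d) - K / 2 * t\<^sup>2 * (norm d)\<^sup>2" for t
  have "\<psi> 1 \<le> \<psi> 0"
  proof (rule DERIV_nonpos_imp_nonincreasing[where f = \<psi>])
    fix t :: real
    assume t: "0 \<le> t" "t \<le> 1"
    let ?D = "grad h (x + t *\<^sub>R d) \<bullet> d - grad h x \<bullet> d - K * t * (norm d)\<^sup>2"
    have "(\<psi> has_real_derivative ?D) (at t)"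
      unfolding \<psi>_def by (auto intro!: derivative_eq_intros has_real_derivative_along_line[OF diff])
    moreover have "?D \<le> 0"
    proof -
      have "(grad h (x + t *\<^sub>R d) - grad h x) \<bullet> d \<le> norm (grad h (x + t *\<^sub>R d) - grad h x) * norm d"
        by (rule norm_cauchy_schwarz)
      also have "\<dots> \<le> K * norm (t *\<^sub>R d) * norm d"
        using lip[of "x + t *\<^sub>R d" x] by (simp add: mult_right_mono)
      finally show ?thesis
        using t by (simp add: inner_diff_left power2_eq_square mult.assoc)
    qed
    ultimately show "\<exists>y. (\<psi> has_real_derivative y) (at t) \<and> y \<le> 0" by blast
  qed simp
  then show ?thesis by (simp add: \<psi>_def d_def)
qed

lemma convex_on_above_tangent_grad:
  fixes h :: "'a::euclidean_space \<Rightarrow> real"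
  assumes convex: "convex_on UNIV h" and diff: "h differentiable at x"
  shows "grad h x \<bullet> (z - x) \<le> h z - h x"
proof -
  define d where "d = z - x"
  have "convex_on UNIV (\<lambda>s::real. h (x + s *\<^sub>R d))"
  proof (rule convex_onI)
    fix t a b :: real
    assume t: "0 < t" "t < 1"
    have "x + ((1 - t) *\<^sub>R a + t *\<^sub>R b) *\<^sub>R d = (1 - t) *\<^sub>R (x + a *\<^sub>R d) + t *\<^sub>R (x + b *\<^sub>R d)"
      by (simp add: algebra_simps)
    then show "h (x + ((1 - t) *\<^sub>R a + t *\<^sub>R b) *\<^sub>R d) \<le> (1 - t) * h (x + a *\<^sub>R d) + t * h (x + b *\<^sub>R d)"
      using convex_onD[OF convex, of t "x + a *\<^sub>R d" "x + b *\<^sub>R d"] t by simp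
  qed simp
  moreover have "((\<lambda>s. h (x + s *\<^sub>R d)) has_real_derivative grad h x \<bullet> d) (at 0)"
    using has_real_derivative_along_line[of h x 0 d] diff by simp
  ultimately have "(grad h x \<bullet> d) * (1 - 0) \<le> h (x + 1 *\<^sub>R d) - h (x + 0 *\<^sub>R d)"
    by (intro convex_on_imp_above_tangent[of UNIV]) auto
  then show ?thesis by (simp add: d_def)
qed

section \<open>Strong convexity: quadratic growth and existence of minimizers\<close>

lemma norm_convex_combination_power2:
  fixes u v :: "'a::real_inner"
  shows "(norm ((1 - t) *\<^sub>R u + t *\<^sub>R v))\<^sup>2 = (1 - t) * (norm u)\<^sup>2 + t * (norm v)\<^sup>2 - t * (1 - t) * (norm (u - v))\<^sup>2"
  unfolding power2_norm_eq_inner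
  by (simp add: inner_add_left inner_add_right inner_diff_left inner_diff_right inner_commute[of v u])
     (simp add: algebra_simps)

text \<open>The modulus is fixed to 1, that of the proximal term. The explicit domain allows real
  values although the model is infinite elsewhere.\<close>

definition strongly_convex_on :: "'a::real_normed_vector set \<Rightarrow> ('a \<Rightarrow> real) \<Rightarrow> bool" where
  "strongly_convex_on D \<phi> \<longleftrightarrow> convex D \<and> (\<forall>u\<in>D. \<forall>v\<in>D. \<forall>t\<in>{0..1}.
     \<phi> ((1 - t) *\<^sub>R u + t *\<^sub>R v) \<le> (1 - t) * \<phi> u + t * \<phi> v - t * (1 - t) / 2 * (norm (u - v))\<^sup>2)"

lemma strongly_convex_onD:
  assumes "strongly_convex_on D \<phi>" "u \<in> D" "v \<in> D" "0 \<le> t" "t \<le> 1"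
  shows "\<phi> ((1 - t) *\<^sub>R u + t *\<^sub>R v) \<le> (1 - t) * \<phi> u + t * \<phi> v - t * (1 - t) / 2 * (norm (u - v))\<^sup>2"
    and "(1 - t) *\<^sub>R u + t *\<^sub>R v \<in> D"
  using assms by (auto simp: strongly_convex_on_def convex_alt)

text \<open>Compare \<open>p\<close> with \<open>(1 - t) *\<^sub>R p + t *\<^sub>R z\<close>, divide
  by \<open>t\<close> and let \<open>t\<close> tend to 0 from the right.\<close>

lemma strongly_convex_on_quadratic_growth:
  assumes sc: "strongly_convex_on D \<phi>" and p: "p \<in> D" "\<And>z. z \<in> D \<Longrightarrow> \<phi> p \<le> \<phi> z" and z: "z \<in> D"
  shows "\<phi> p + 1 / 2 * (norm (z - p))\<^sup>2 \<le> \<phi> z"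
proof -
  let ?N = "(norm (p - z))\<^sup>2"
  have "\<phi> p + (1 - t) / 2 * ?N \<le> \<phi> z" if t: "0 < t" "t < 1" for t
  proof -
    have "\<phi> p \<le> (1 - t) * \<phi> p + t * \<phi> z - t * (1 - t) / 2 * ?N"
      using strongly_convex_onD[OF sc p(1) z, of t] p(2) t by force
    then have "t * (\<phi> p + (1 - t) / 2 * ?N) \<le> t * \<phi> z" by (simp add: algebra_simps)
    then show ?thesis using t by simp
  qed
  then have "\<forall>\<^sub>F t in at_right 0. \<phi> p + (1 - t) / 2 * ?N \<le> \<phi> z"
    unfolding eventually_at_right_field by (intro exI[of _ 1]) auto
  moreover have "((\<lambda>t. \<phi> p + (1 - t) / 2 * ?N) \<longlongrightarrow> \<phi> p + (1 - 0) / 2 * ?N) (at_right 0)"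
    by (intro tendsto_intros) auto
  ultimately have "\<phi> p + (1 - 0) / 2 * ?N \<le> \<phi> z"
    by (intro tendsto_upperbound) auto
  then show ?thesis by (simp add: norm_minus_commute)
qed

text \<open>Weierstrass for closed sublevel sets: the sublevel sets at values taken on
  \<open>K \<inter> D\<close>, cut with \<open>K\<close>, form a chain of nonempty compact sets, and
  a common point is a minimizer.\<close>

lemma closed_sublevels_attains_min:
  fixes \<phi> :: "'a::euclidean_space \<Rightarrow> real"
  assumes K: "compact K" and x: "x \<in> K" "x \<in> D" and closed: "\<And>c. closed {z \<in> D. \<phi> z \<le> c}"
  obtains p where "p \<in> K \<inter> D" "\<And>z. z \<in> K \<inter> D \<Longrightarrow> \<phi> p \<le> \<phi> z"
proof -
  let ?S = "\<lambda>y. K \<inter> {z \<in> D. \<phi> z \<le> \<phi> y}"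
  have "\<Inter>(?S ` (K \<inter> D)) \<noteq> {}"
  proof (rule compact_chain)
    show "\<And>S. S \<in> ?S ` (K \<inter> D) \<Longrightarrow> compact S"
      using K closed by (auto intro: compact_Int_closed)
    show "{} \<notin> ?S ` (K \<inter> D)" by auto
    fix S T assume "S \<in> ?S ` (K \<inter> D) \<and> T \<in> ?S ` (K \<inter> D)"
    then obtain a b where "S = ?S a" "T = ?S b" by blast
    moreover have "\<phi> a \<le> \<phi> b \<or> \<phi> b \<le> \<phi> a" by linarith
    ultimately show "S \<subseteq> T \<or> T \<subseteq> S"
      by (elim disjE) (auto intro: order_trans)
  qed
  then obtain p where "\<And>y. y \<in> K \<inter> D \<Longrightarrow> p \<in> ?S y" by blast
  with x show thesis by (intro that[of p]) blast+
qed

text \<open>A minimum over the unit ball around \<open>x\<close> bounds \<open>\<phi>\<close> below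
  there; strong convexity along rays from \<open>x\<close> turns this into growth far away, so a
  minimizer over a larger ball is global.\<close>

lemma strongly_convex_on_attains_min:
  fixes \<phi> :: "'a::euclidean_space \<Rightarrow> real"
  assumes sc: "strongly_convex_on D \<phi>" and x: "x \<in> D" and closed: "\<And>c. closed {z \<in> D. \<phi> z \<le> c}"
  obtains p where "p \<in> D" "\<And>z. z \<in> D \<Longrightarrow> \<phi> p + 1 / 2 * (norm (z - p))\<^sup>2 \<le> \<phi> z"
proof -
  obtain q where q: "q \<in> cball x 1 \<inter> D" "\<And>z. z \<in> cball x 1 \<inter> D \<Longrightarrow> \<phi> q \<le> \<phi> z"
    by (rule closed_sublevels_attains_min[of "cball x 1" x D \<phi>]) (use x closed in auto)
  \<comment> \<open>The radius beyond which \<open>(norm (z - x) - 1) / 2\<close> exceeds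
    \<open>\<phi> x - \<phi> q\<close>.\<close>
  define r where "r = 1 + 2 * (\<phi> x - \<phi> q)"
  have q_le: "\<phi> q \<le> \<phi> x" using q(2)[of x] x by simp
  have far: "\<phi> x < \<phi> z" if z: "z \<in> D" "r < norm (z - x)" for z
  proof -
    let ?n = "norm (z - x)"
    have n: "1 < ?n" using z q_le by (simp add: r_def)
    \<comment> \<open>This \<open>t\<close> puts \<open>?w\<close> on the unit sphere around
      \<open>x\<close>, where \<open>q\<close> is a lower competitor.\<close>
    define t where "t = 1 / ?n"
    have t: "0 < t" "t < 1" "t * ?n = 1" using n by (auto simp: t_def divide_less_eq_1)
    let ?w = "(1 - t) *\<^sub>R x + t *\<^sub>R z"
    have "?w - x = t *\<^sub>R (z - x)" by (simp add: algebra_simps)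
    then have "norm (?w - x) = 1" using t by simp
    then have "?w \<in> cball x 1" by (simp add: dist_norm norm_minus_commute)
    then have "\<phi> q \<le> (1 - t) * \<phi> x + t * \<phi> z - t * (1 - t) / 2 * ?n\<^sup>2"
      using strongly_convex_onD[OF sc x z(1), of t] q(2)[of ?w] t by (simp add: norm_minus_commute)
    then have "?n * \<phi> q \<le> ?n * ((1 - t) * \<phi> x + t * \<phi> z - t * (1 - t) / 2 * ?n\<^sup>2)"
      by (rule mult_left_mono) simp
    also have "\<dots> = (?n - t * ?n) * \<phi> x + (t * ?n) * \<phi> z - (t * ?n) * (?n - t * ?n) / 2 * ?n"
      by (simp add: algebra_simps power2_eq_square)
    also have "\<dots> = (?n - 1) * \<phi> x + \<phi> z - (?n - 1) / 2 * ?n"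
      by (simp only: t(3))
    finally have "\<phi> x + ?n * (\<phi> q - \<phi> x + (?n - 1) / 2) \<le> \<phi> z"
      by (simp add: algebra_simps)
    moreover have "0 < ?n * (\<phi> q - \<phi> x + (?n - 1) / 2)"
      using n z(2) by (intro mult_pos_pos) (auto simp: r_def field_simps)
    ultimately show ?thesis by linarith
  qed
  obtain p where p: "p \<in> cball x r \<inter> D" "\<And>z. z \<in> cball x r \<inter> D \<Longrightarrow> \<phi> p \<le> \<phi> z"
    by (rule closed_sublevels_attains_min[of "cball x r" x D \<phi>]) (use x closed q_le in \<open>auto simp: r_def\<close>)
  have "\<phi> p \<le> \<phi> z" if "z \<in> D" for z
  proof (cases "z \<in> cball x r")
    case True
    then show ?thesis using p(2) that by blast
  next
    case False
    then have "\<phi> x < \<phi> z" using far[OF that] by (simp add: dist_norm norm_minus_commute)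
    moreover have "\<phi> p \<le> \<phi> x" using p(2)[of x] x q_le by (simp add: r_def)
    ultimately show ?thesis by linarith
  qed
  then show thesis
    using p(1) strongly_convex_on_quadratic_growth[OF sc] by (intro that[of p]) auto
qed

text \<open>The bound is a continuous function instead of a constant, so that continuous summands of
  an objective can be moved into it.\<close>

lemma closed_sublevel_lsc_fun:
  fixes h :: "'a::metric_space \<Rightarrow> ereal"
  assumes lsc: "lsc_fun h" and u: "continuous_on UNIV u"
  shows "closed {z. h z \<le> ereal (u z)}"
proof -
  have "open {z. ereal (u z) < h z}"
  proof (subst open_subopen, safe)
    fix z assume "ereal (u z) < h z"
    then obtain d where d: "ereal (u z) < d" "d < h z" using dense by blast
    have "h z \<le> Liminf (at z) h" using lsc by (simp add: lsc_fun_def)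
    with d(2) have "\<forall>\<^sub>F y in at z. d < h y" by (auto simp: le_Liminf_iff)
    \<comment> \<open>The \<open>Liminf\<close> ignores the point \<open>z\<close> itself; there
      \<open>d < h z\<close> supplies the bound.\<close>
    with d(2) have "\<forall>\<^sub>F y in nhds z. d < h y" by (auto simp: eventually_nhds_conv_at)
    moreover have "\<forall>\<^sub>F y in nhds z. ereal (u y) < d"
    proof (rule order_tendstoD(2)[OF _ d(1)])
      have "continuous_on UNIV (\<lambda>y. ereal (u y))" using u by (intro continuous_intros)
      then show "((\<lambda>y. ereal (u y)) \<longlongrightarrow> ereal (u z)) (nhds z)"
        by (simp add: continuous_on_eq_continuous_at continuous_at tendsto_nhds_iff)
    qed
    ultimately have "\<forall>\<^sub>F y in nhds z. ereal (u y) < h y"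
      by eventually_elim simp
    then show "\<exists>T. open T \<and> z \<in> T \<and> T \<subseteq> {z. ereal (u z) < h z}"
      unfolding eventually_nhds by blast
  qed
  moreover have "{z. h z \<le> ereal (u z)} = - {z. ereal (u z) < h z}" by auto
  ultimately show ?thesis by (metis closed_def double_complement)
qed

section \<open>The composite problem in real-valued form on the effective domain\<close>

locale composite_problem =
  fixes f :: "'m::finite \<Rightarrow> 'a::euclidean_space \<Rightarrow> real"
    and g :: "'m \<Rightarrow> 'a \<Rightarrow> ereal"
    and L :: "'m \<Rightarrow> real"
  assumes f_smooth: "\<And>i. smooth_fun (L i) (f i)"
    and f_convex: "\<And>i. convex_on UNIV (f i)"
    and g_proper: "\<And>i. proper_fun (g i)"
    and g_convex: "\<And>i. convex_fun (g i)"
    and g_lsc: "\<And>i. lsc_fun (g i)"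
    and L_pos: "\<And>i. 0 < L i"
begin

definition eff_dom :: "'a set" where
  "eff_dom = {z. \<forall>i. g i z < \<infinity>}"

text \<open>Since \<open>real_of_ereal\<close> sends infinity to 0, agreement with \<open>g\<close>
  is guaranteed only on \<open>eff_dom\<close>.\<close>

definition gr :: "'m \<Rightarrow> 'a \<Rightarrow> real" where
  "gr i z = real_of_ereal (g i z)"

definition Fr :: "'m \<Rightarrow> 'a \<Rightarrow> real" where
  "Fr i z = f i z + gr i z"

definition model_component :: "('m \<Rightarrow> real) \<Rightarrow> 'a \<Rightarrow> 'm \<Rightarrow> 'a \<Rightarrow> real" where
  "model_component a x i z = (grad (f i) x \<bullet> (z - x) + gr i z - gr i x) / a i + 1 / 2 * (norm (z - x))\<^sup>2"

definition model :: "('m \<Rightarrow> real) \<Rightarrow> 'a \<Rightarrow> 'a \<Rightarrow> real" where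
  "model a x z = (MAX i. model_component a x i z)"

lemma in_dom_if_le:
  assumes "\<And>i. g i z \<le> ereal (r i)"
  shows "z \<in> eff_dom"
proof -
  have "g i z < \<infinity>" for i
    using assms[of i] by (rule le_less_trans) simp
  then show ?thesis by (simp add: eff_dom_def)
qed

lemma f_differentiable: "f i differentiable at z"
  using f_smooth by (simp add: smooth_fun_def)

lemma g_gt_MInf: "- \<infinity> < g i z"
  using g_proper by (simp add: proper_fun_def)

lemma g_eq_gr: "z \<in> eff_dom \<Longrightarrow> g i z = ereal (gr i z)"
  using g_gt_MInf[of i z] by (cases "g i z") (auto simp: eff_dom_def gr_def)

lemma F_eq_Fr: "z \<in> eff_dom \<Longrightarrow> ereal (f i z) + g i z = ereal (Fr i z)"
  by (simp add: g_eq_gr Fr_def)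

text \<open>Although \<open>eff_dom\<close> need not be closed, finite bounds on all
  \<open>g i\<close> already force membership in it, so the set is an intersection of closed
  extended-valued sublevel sets.\<close>

lemma closed_gr_sublevel:
  assumes "\<And>i. continuous_on UNIV (u i)"
  shows "closed {z \<in> eff_dom. \<forall>i. gr i z \<le> u i z}"
proof -
  have "{z \<in> eff_dom. \<forall>i. gr i z \<le> u i z} = (\<Inter>i. {z. g i z \<le> ereal (u i z)})"
  proof (intro set_eqI iffI)
    fix z assume "z \<in> (\<Inter>i. {z. g i z \<le> ereal (u i z)})"
    then have le: "g i z \<le> ereal (u i z)" for i by blast
    then have "z \<in> eff_dom" by (rule in_dom_if_le)
    with le show "z \<in> {z \<in> eff_dom. \<forall>i. gr i z \<le> u i z}" by (simp add: g_eq_gr)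
  qed (simp add: g_eq_gr)
  then show ?thesis
    using closed_sublevel_lsc_fun[OF g_lsc assms] by (simp add: closed_INT)
qed

lemma
  assumes u: "u \<in> eff_dom" and v: "v \<in> eff_dom" and t: "0 \<le> t" "t \<le> 1"
  shows convex_combination_in_dom: "(1 - t) *\<^sub>R u + t *\<^sub>R v \<in> eff_dom"
    and gr_convex_combination: "gr i ((1 - t) *\<^sub>R u + t *\<^sub>R v) \<le> (1 - t) * gr i u + t * gr i v"
proof -
  let ?w = "(1 - t) *\<^sub>R u + t *\<^sub>R v"
  have le: "g j ?w \<le> ereal ((1 - t) * gr j u + t * gr j v)" for j
  proof -
    have "g j ?w \<le> ereal (1 - t) * g j u + ereal t * g j v"
      using g_convex[of j] t unfolding convex_fun_def by simp
    then show ?thesis by (simp add: g_eq_gr[OF u] g_eq_gr[OF v])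
  qed
  then show w: "?w \<in> eff_dom" by (rule in_dom_if_le)
  show "gr i ?w \<le> (1 - t) * gr i u + t * gr i v"
    using le[of i] by (simp add: g_eq_gr[OF w])
qed

text \<open>The linear term and \<open>gr i\<close>, divided by the positive \<open>a i\<close>,
  form a convex part; the squared norm contributes exactly the modulus 1.\<close>

lemma strongly_convex_on_comp:
  assumes a: "0 < a i"
  shows "strongly_convex_on eff_dom (model_component a x i)"
  unfolding strongly_convex_on_def
proof (intro conjI ballI)
  show "convex eff_dom"
    unfolding convex_alt by (auto intro: convex_combination_in_dom)
next
  fix u v and t :: real
  assume uv: "u \<in> eff_dom" "v \<in> eff_dom" and "t \<in> {0..1}"
  then have t: "0 \<le> t" "t \<le> 1" by auto
  define w where "w = (1 - t) *\<^sub>R u + t *\<^sub>R v"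
  define h where "h z = (grad (f i) x \<bullet> (z - x) + gr i z - gr i x) / a i" for z
  have w: "w - x = (1 - t) *\<^sub>R (u - x) + t *\<^sub>R (v - x)"
    by (simp add: w_def algebra_simps)
  have "grad (f i) x \<bullet> (w - x) + gr i w - gr i x
      \<le> (1 - t) * (grad (f i) x \<bullet> (u - x) + gr i u - gr i x) + t * (grad (f i) x \<bullet> (v - x) + gr i v - gr i x)"
    unfolding w inner_add_right inner_scaleR_right
    using gr_convex_combination[OF uv t, of i] by (simp add: w_def algebra_simps)
  then have "h w \<le> ((1 - t) * (grad (f i) x \<bullet> (u - x) + gr i u - gr i x) + t * (grad (f i) x \<bullet> (v - x) + gr i v - gr i x)) / a i"
    unfolding h_def using a by (intro divide_right_mono) auto
  then have "h w \<le> (1 - t) * h u + t * h v"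
    by (simp add: h_def add_divide_distrib)
  moreover have "(norm (w - x))\<^sup>2 = (1 - t) * (norm (u - x))\<^sup>2 + t * (norm (v - x))\<^sup>2 - t * (1 - t) * (norm (u - v))\<^sup>2"
    unfolding w norm_convex_combination_power2 by simp
  moreover have "model_component a x i z = h z + 1 / 2 * (norm (z - x))\<^sup>2" for z
    by (simp add: model_component_def h_def)
  ultimately have "model_component a x i w \<le> (1 - t) * model_component a x i u + t * model_component a x i v - t * (1 - t) / 2 * (norm (u - v))\<^sup>2"
    by (simp add: algebra_simps add_divide_distrib diff_divide_distrib)
  then show "model_component a x i ((1 - t) *\<^sub>R u + t *\<^sub>R v) \<le> (1 - t) * model_component a x i u + t * model_component a x i v - t * (1 - t) / 2 * (norm (u - v))\<^sup>2"
    by (simp add: w_def)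
qed

lemma model_le_iff: "model a x z \<le> c \<longleftrightarrow> (\<forall>i. model_component a x i z \<le> c)"
  by (simp add: model_def)

lemma comp_le_model: "model_component a x i z \<le> model a x z"
  by (simp add: model_def)

lemma model_eq_comp: obtains i where "model a x z = model_component a x i z"
proof -
  have "model a x z \<in> range (\<lambda>i. model_component a x i z)"
    unfolding model_def by (rule Max_in) auto
  then show thesis using that by blast
qed

lemma strongly_convex_on_model:
  assumes a: "\<And>i. 0 < a i"
  shows "strongly_convex_on eff_dom (model a x)"
proof -
  have sc: "strongly_convex_on eff_dom (model_component a x i)" for i
    by (rule strongly_convex_on_comp[OF a])
  have "model a x ((1 - t) *\<^sub>R u + t *\<^sub>R v) \<le> (1 - t) * model a x u + t * model a x v - t * (1 - t) / 2 * (norm (u - v))\<^sup>2"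
    if "u \<in> eff_dom" "v \<in> eff_dom" "t \<in> {0..1}" for u v t
    unfolding model_le_iff
  proof
    fix i
    have t: "0 \<le> t" "t \<le> 1" using that by auto
    have "model_component a x i ((1 - t) *\<^sub>R u + t *\<^sub>R v) \<le> (1 - t) * model_component a x i u + t * model_component a x i v - t * (1 - t) / 2 * (norm (u - v))\<^sup>2"
      using strongly_convex_onD(1)[OF sc that(1,2) t] .
    also have "\<dots> \<le> (1 - t) * model a x u + t * model a x v - t * (1 - t) / 2 * (norm (u - v))\<^sup>2"
      using t by (intro diff_right_mono add_mono mult_left_mono comp_le_model) auto
    finally show "model_component a x i ((1 - t) *\<^sub>R u + t *\<^sub>R v) \<le> (1 - t) * model a x u + t * model a x v - t * (1 - t) / 2 * (norm (u - v))\<^sup>2" .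
  qed
  with sc show ?thesis by (auto simp: strongly_convex_on_def)
qed

lemma closed_model_sublevel:
  assumes a: "\<And>i. 0 < a i"
  shows "closed {z \<in> eff_dom. model a x z \<le> c}"
proof -
  \<comment> \<open>Obtained by solving \<open>model_component a x i z \<le> c\<close> for
    \<open>gr i z\<close>.\<close>
  define u where "u i z = a i * (c - 1 / 2 * (norm (z - x))\<^sup>2) - grad (f i) x \<bullet> (z - x) + gr i x" for i z
  have "model_component a x i z \<le> c \<longleftrightarrow> gr i z \<le> u i z" for i z
    using a[of i] by (simp add: model_component_def u_def field_simps)
  then have "{z \<in> eff_dom. model a x z \<le> c} = {z \<in> eff_dom. \<forall>i. gr i z \<le> u i z}"
    by (simp add: model_le_iff)
  moreover have "continuous_on UNIV (u i)" for i
    unfolding u_def by (intro continuous_intros)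
  ultimately show ?thesis by (simp add: closed_gr_sublevel)
qed

section \<open>The proximal step and its basic inequality\<close>

lemma prox_model_eq_model:
  assumes a: "\<And>i. 0 < a i" and x: "x \<in> eff_dom" and z: "z \<in> eff_dom"
  shows "prox_model f g a x z = ereal (model a x z)"
proof -
  have "(ereal (grad (f i) x \<bullet> (z - x)) + g i z - g i x) / ereal (a i) + ereal (1 / 2 * (norm (z - x))\<^sup>2) = ereal (model_component a x i z)" for i
    using a[of i] by (simp add: g_eq_gr x z model_component_def)
  then show ?thesis
    unfolding prox_model_def model_def
    by (subst mono_Max_commute[of ereal]) (auto simp: mono_def image_image)
qed

lemma prox_model_eq_PInf:
  assumes a: "\<And>i. 0 < a i" and x: "x \<in> eff_dom" and z: "z \<notin> eff_dom"
  shows "prox_model f g a x z = \<infinity>"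
proof -
  obtain i where "g i z = \<infinity>" using z by (auto simp: eff_dom_def)
  then have "(ereal (grad (f i) x \<bullet> (z - x)) + g i z - g i x) / ereal (a i) + ereal (1 / 2 * (norm (z - x))\<^sup>2) = \<infinity>"
    using a[of i] by (simp add: g_eq_gr x)
  then have "\<infinity> \<le> prox_model f g a x z"
    unfolding prox_model_def by (intro Max_ge) (auto intro: rev_image_eqI)
  then show ?thesis by simp
qed

text \<open>Quadratic growth at a minimizer \<open>p\<close> of the real-valued model forces every
  minimizer to equal \<open>p\<close>, so the definite description in \<open>prox_step\<close>
  denotes \<open>p\<close>.\<close>

lemma
  assumes a: "\<And>i. 0 < a i" and x: "x \<in> eff_dom"
  shows prox_step_in_dom: "prox_step f g a x \<in> eff_dom"
    and prox_step_quadratic_growth: "z \<in> eff_dom \<Longrightarrow>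
      model a x (prox_step f g a x) + 1 / 2 * (norm (z - prox_step f g a x))\<^sup>2 \<le> model a x z"
proof -
  obtain p where p: "p \<in> eff_dom" "\<And>z. z \<in> eff_dom \<Longrightarrow> model a x p + 1 / 2 * (norm (z - p))\<^sup>2 \<le> model a x z"
    by (rule strongly_convex_on_attains_min[OF strongly_convex_on_model[of a x, OF a] x
          closed_model_sublevel[of a x, OF a]]) (rule that)
  note eq = prox_model_eq_model[of a, OF a x] and PInf = prox_model_eq_PInf[of a, OF a x]
  have "is_arg_min (prox_model f g a x) (\<lambda>_. True) z \<longleftrightarrow> z = p" for z
  proof
    assume min: "is_arg_min (prox_model f g a x) (\<lambda>_. True) z"
    then have le: "prox_model f g a x z \<le> prox_model f g a x p"
      by (auto simp: is_arg_min_def not_less)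
    \<comment> \<open>The value at \<open>p\<close> is finite, whereas the model is infinite off
      \<open>eff_dom\<close>.\<close>
    then have z: "z \<in> eff_dom"
      using PInf[of z] eq[OF p(1)] by (cases "z \<in> eff_dom") auto
    have "model a x z \<le> model a x p"
      using le by (simp add: eq p(1) z)
    with p(2)[OF z] have "(norm (z - p))\<^sup>2 \<le> 0" by linarith
    then show "z = p" by simp
  next
    assume "z = p"
    moreover have "prox_model f g a x p \<le> prox_model f g a x y" for y
    proof (cases "y \<in> eff_dom")
      case True
      have "model a x p \<le> model a x y"
        using p(2)[OF True] zero_le_power2[of "norm (y - p)"] by linarith
      then show ?thesis by (simp add: eq p(1) True)
    qed (simp add: PInf)
    ultimately show "is_arg_min (prox_model f g a x) (\<lambda>_. True) z"
      by (simp add: is_arg_min_def not_less)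
  qed
  then have "prox_step f g a x = p"
    by (simp add: prox_step_def)
  with p show "prox_step f g a x \<in> eff_dom"
    and "z \<in> eff_dom \<Longrightarrow> model a x (prox_step f g a x) + 1 / 2 * (norm (z - prox_step f g a x))\<^sup>2 \<le> model a x z"
    by auto
qed

text \<open>The index is the one at which the maximum in the model is attained at \<open>z\<close>; this choice
  takes the place of the Lagrange multipliers of the max-type subproblem.\<close>

lemma prox_step_estimate:
  assumes a: "\<And>i. 0 < a i" and x: "x \<in> eff_dom" and z: "z \<in> eff_dom"
    and p: "p = prox_step f g a x" and ok: "\<And>i. descent_ok f a x p i"
  obtains i where "\<And>j. (Fr j p - Fr j x) / a j + 1 / 2 * (norm (z - p))\<^sup>2
      \<le> (Fr i z - Fr i x) / a i + 1 / 2 * (norm (z - x))\<^sup>2"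
proof -
  obtain i where i: "model a x z = model_component a x i z" by (rule model_eq_comp)
  \<comment> \<open>At \<open>z\<close> the linearization of \<open>f i\<close> lies below
    \<open>f i\<close> by convexity.\<close>
  have "model_component a x i z \<le> (Fr i z - Fr i x) / a i + 1 / 2 * (norm (z - x))\<^sup>2"
    using convex_on_above_tangent_grad[OF f_convex f_differentiable, of i x z] a[of i]
    by (simp add: model_component_def Fr_def divide_right_mono)
  \<comment> \<open>At \<open>p\<close> the descent condition bounds every component below, so
    \<open>j\<close> stays independent of \<open>i\<close>.\<close>
  moreover have "(Fr j p - Fr j x) / a j \<le> model_component a x j p" for j
  proof -
    let ?N = "1 / 2 * (norm (p - x))\<^sup>2"
    have "(Fr j p - Fr j x) / a j \<le> (grad (f j) x \<bullet> (p - x) + gr j p - gr j x + a j * ?N) / a j"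
      using ok[of j] a[of j] by (intro divide_right_mono) (auto simp: Fr_def descent_ok_def)
    also have "\<dots> = model_component a x j p"
      using a[of j] by (simp add: model_component_def add_divide_distrib)
    finally show ?thesis .
  qed
  moreover have "model_component a x j p + 1 / 2 * (norm (z - p))\<^sup>2 \<le> model a x z" for j
    using prox_step_quadratic_growth[of a, OF a x z] comp_le_model[of a x j p] by (auto simp: p)
  ultimately show thesis
    using i by (intro that[of i]) (smt (verit))
qed

text \<open>The choice \<open>z = x\<close> makes the right-hand side of the estimate vanish,
  whatever the index \<open>i\<close> is.\<close>

lemma prox_step_decrease:
  assumes a: "\<And>i. 0 < a i" and x: "x \<in> eff_dom"
    and p: "p = prox_step f g a x" and ok: "\<And>i. descent_ok f a x p i"
  shows "Fr j p \<le> Fr j x"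
proof -
  obtain i where "(Fr j p - Fr j x) / a j + 1 / 2 * (norm (x - p))\<^sup>2
      \<le> (Fr i x - Fr i x) / a i + 1 / 2 * (norm (x - x))\<^sup>2"
    using prox_step_estimate[OF a x x p ok] by metis
  then have "(Fr j p - Fr j x) / a j + 1 / 2 * (norm (x - p))\<^sup>2 \<le> 0" by simp
  then have "(Fr j p - Fr j x) / a j \<le> 0"
    using zero_le_power2[of "norm (x - p)"] by linarith
  then show ?thesis using a[of j] by (simp add: divide_le_0_iff)
qed

text \<open>The choice \<open>j = i\<close> cancels the values at \<open>x\<close>.\<close>

lemma prox_step_fejer:
  assumes a: "\<And>i. 0 < a i" and x: "x \<in> eff_dom" and z: "z \<in> eff_dom"
    and p: "p = prox_step f g a x" and ok: "\<And>i. descent_ok f a x p i"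
  obtains i where "(Fr i p - Fr i z) / a i \<le> 1 / 2 * (norm (z - x))\<^sup>2 - 1 / 2 * (norm (z - p))\<^sup>2"
proof -
  obtain i where "(Fr i p - Fr i x) / a i + 1 / 2 * (norm (z - p))\<^sup>2
      \<le> (Fr i z - Fr i x) / a i + 1 / 2 * (norm (z - x))\<^sup>2"
    using prox_step_estimate[OF a x z p ok] by metis
  moreover have "(Fr i p - Fr i z) / a i = (Fr i p - Fr i x) / a i - (Fr i z - Fr i x) / a i"
    by (simp add: diff_divide_distrib)
  ultimately show thesis by (intro that[of i]) linarith
qed

section \<open>Bounds on the initial and the backtracked parameters\<close>

lemma descent_ok_if_L_le:
  assumes "L i \<le> a i"
  shows "descent_ok f a x z i"
proof -
  have "L i / 2 * (norm (z - x))\<^sup>2 \<le> a i / 2 * (norm (z - x))\<^sup>2"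
    using assms by (intro mult_right_mono) auto
  then show ?thesis
    using smooth_fun_upper_bound[OF f_smooth, of i z x] by (simp add: descent_ok_def)
qed

text \<open>A parameter is multiplied by \<open>\<tau>\<close> only if its descent condition fails,
  hence only while it is below \<open>L i\<close>.\<close>

lemma inflate_bounds:
  assumes \<tau>: "1 < \<tau>" and a: "0 < a i" "a i \<le> \<tau> * L i"
  shows "0 < inflate f g \<tau> x a i" "inflate f g \<tau> x a i \<le> \<tau> * L i"
proof -
  show "0 < inflate f g \<tau> x a i" using \<tau> a by (simp add: inflate_def)
  show "inflate f g \<tau> x a i \<le> \<tau> * L i"
    using \<tau> a descent_ok_if_L_le[of i a] by (auto simp: inflate_def) (meson linear)
qed

text \<open>The bounds are a loop invariant and the descent condition is the negated guard. The loop
  starts from \<open>inflate f g \<tau> x a\<close>, which satisfies the bounds as well.\<close>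

lemma backtrack_Some:
  assumes \<tau>: "1 < \<tau>" and a: "\<forall>i. 0 < a i \<and> a i \<le> \<tau> * L i"
    and b: "backtrack f g \<tau> x a = Some b"
  shows "0 < b i" "b i \<le> \<tau> * L i" "descent_ok f b x (prox_step f g b x) i"
proof -
  have "\<forall>i. 0 < b i \<and> b i \<le> \<tau> * L i"
    by (rule while_option_rule[OF _ b[unfolded backtrack_def]]) (use inflate_bounds[OF \<tau>] a in auto)
  then show "0 < b i" "b i \<le> \<tau> * L i" by auto
  show "descent_ok f b x (prox_step f g b x) i"
    using while_option_stop[OF b[unfolded backtrack_def]] by simp
qed

text \<open>Both Barzilai-Borwein quotients are at most \<open>L i\<close> by the Lipschitz bound
  and Cauchy-Schwarz. If \<open>x = y\<close>, they are 0 by the convention for division by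
  0.\<close>

lemma bb_init_bounds:
  assumes "0 < \<alpha>min" "\<alpha>min \<le> L i"
  shows "0 < bb_init f \<alpha>min \<alpha>max y x i" "bb_init f \<alpha>min \<alpha>max y x i \<le> L i"
proof -
  let ?s = "x - y" and ?y = "grad (f i) x - grad (f i) y"
  have lip: "norm ?y \<le> L i * norm ?s"
    using f_smooth[of i] by (simp add: smooth_fun_def)
  have "norm ?y / norm ?s \<le> L i"
    using lip L_pos[of i] by (cases "norm ?s = 0") (auto simp: divide_le_eq)
  moreover have "(?s \<bullet> ?y) / (?s \<bullet> ?s) \<le> L i"
  proof (cases "?s = 0")
    case False
    have "?s \<bullet> ?y \<le> norm ?s * norm ?y" by (rule norm_cauchy_schwarz)
    also have "\<dots> \<le> L i * (?s \<bullet> ?s)"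
      using mult_left_mono[OF lip, of "norm ?s"] by (simp add: dot_square_norm power2_eq_square mult_ac)
    finally show ?thesis using False by (simp add: divide_le_eq)
  qed (use L_pos[of i] in simp)
  ultimately show "bb_init f \<alpha>min \<alpha>max y x i \<le> L i"
    using assms by (auto simp: bb_init_def Let_def min_le_iff_disj)
  show "0 < bb_init f \<alpha>min \<alpha>max y x i"
    using assms by (auto simp: bb_init_def Let_def less_max_iff_disj)
qed

lemma closed_Fr_sublevel: "closed {z \<in> eff_dom. \<forall>i. Fr i z \<le> c i}"
proof -
  have "continuous_on UNIV (\<lambda>z. c i - f i z)" for i
    by (intro continuous_intros)
      (simp add: f_differentiable differentiable_imp_continuous_within continuous_on_eq_continuous_at)
  then have "closed {z \<in> eff_dom. \<forall>i. gr i z \<le> c i - f i z}"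
    by (rule closed_gr_sublevel)
  then show ?thesis by (simp add: Fr_def le_diff_eq add.commute)
qed

lemma F_less_PInf_iff: "(\<forall>i. ereal (f i z) + g i z < \<infinity>) \<longleftrightarrow> z \<in> eff_dom"
proof -
  have "ereal (f i z) + g i z < \<infinity> \<longleftrightarrow> g i z < \<infinity>" for i
    by (cases "g i z") auto
  then show ?thesis by (simp add: eff_dom_def)
qed

text \<open>The index delivered by \<open>prox_step_fejer\<close> is unknown, so the gap is assumed
  for all \<open>i\<close>; scaling it by \<open>\<tau> * L i\<close> makes the conclusion free of
  the step-dependent \<open>a\<close>.\<close>

lemma backtracked_step:
  assumes \<tau>: "1 < \<tau>" and a0: "\<forall>i. 0 < a0 i \<and> a0 i \<le> \<tau> * L i" and x: "x \<in> eff_dom"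
    and bt: "backtrack f g \<tau> x a0 = Some a" and p: "p = prox_step f g a x"
  shows "p \<in> eff_dom" and "Fr i p \<le> Fr i x"
    and "\<lbrakk>z \<in> eff_dom; 0 \<le> \<delta>; \<And>i. \<delta> * (\<tau> * L i) \<le> Fr i p - Fr i z\<rbrakk>
      \<Longrightarrow> \<delta> \<le> 1 / 2 * (norm (z - x))\<^sup>2 - 1 / 2 * (norm (z - p))\<^sup>2"
proof -
  have a: "0 < a j" "a j \<le> \<tau> * L j" and ok: "descent_ok f a x p j" for j
    using backtrack_Some[OF \<tau> a0 bt, of j] by (simp_all add: p)
  show "p \<in> eff_dom" unfolding p by (rule prox_step_in_dom[OF a(1) x])
  show "Fr i p \<le> Fr i x" by (rule prox_step_decrease[OF a(1) x p ok])
  assume z: "z \<in> eff_dom" and \<delta>: "0 \<le> \<delta>" and le: "\<And>i. \<delta> * (\<tau> * L i) \<le> Fr i p - Fr i z"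
  obtain j where j: "(Fr j p - Fr j z) / a j \<le> 1 / 2 * (norm (z - x))\<^sup>2 - 1 / 2 * (norm (z - p))\<^sup>2"
    by (rule prox_step_fejer[OF a(1) x z p ok])
  have "\<delta> * a j \<le> Fr j p - Fr j z"
    using mult_left_mono[OF a(2)[of j] \<delta>] le[of j] by linarith
  then have "\<delta> \<le> (Fr j p - Fr j z) / a j"
    using a(1)[of j] by (simp add: pos_le_divide_eq)
  with j show "\<delta> \<le> 1 / 2 * (norm (z - x))\<^sup>2 - 1 / 2 * (norm (z - p))\<^sup>2" by linarith
qed

end

section \<open>The generated sequence: rate and convergence\<close>

locale abbpgmo_sequence = composite_problem f g L
  for f :: "'m::finite \<Rightarrow> 'a::euclidean_space \<Rightarrow> real" and g L +
  fixes \<tau> \<alpha>min \<alpha>max :: real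
    and xm1 :: 'a
    and x :: "nat \<Rightarrow> 'a"
  assumes \<tau>: "1 < \<tau>"
    and \<alpha>min: "0 < \<alpha>min" "\<And>i. \<alpha>min \<le> L i"
    and run: "abbpgmo f g \<tau> \<alpha>min \<alpha>max xm1 x"
    and x0: "x 0 \<in> eff_dom"
begin

lemma \<tau>L_pos: "0 < \<tau> * L i"
  using \<tau> L_pos[of i] by simp

lemma step_backtracked:
  obtains a0 a where "\<forall>i. 0 < a0 i \<and> a0 i \<le> \<tau> * L i"
    "backtrack f g \<tau> (x k) a0 = Some a" "x (Suc k) = prox_step f g a (x k)"
proof -
  define a0 where "a0 = bb_init f \<alpha>min \<alpha>max (case k of 0 \<Rightarrow> xm1 | Suc j \<Rightarrow> x j) (x k)"
  obtain a where a: "backtrack f g \<tau> (x k) a0 = Some a" "x (Suc k) = prox_step f g a (x k)"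
    using run unfolding abbpgmo_def Let_def a0_def by blast
  have "0 < a0 i" for i
    unfolding a0_def by (rule bb_init_bounds[OF \<alpha>min])
  moreover have "a0 i \<le> \<tau> * L i" for i
  proof -
    have "a0 i \<le> L i" unfolding a0_def by (rule bb_init_bounds[OF \<alpha>min])
    also have "\<dots> \<le> \<tau> * L i" using \<tau> L_pos[of i] by simp
    finally show ?thesis .
  qed
  ultimately show thesis using a by (intro that[of a0 a]) auto
qed

lemma x_in_dom: "x k \<in> eff_dom"
proof (induction k)
  case (Suc k)
  obtain a0 a where "\<forall>i. 0 < a0 i \<and> a0 i \<le> \<tau> * L i"
    "backtrack f g \<tau> (x k) a0 = Some a" "x (Suc k) = prox_step f g a (x k)"
    by (rule step_backtracked[of k])
  from backtracked_step(1)[OF \<tau> this(1) Suc this(2,3)] show ?case .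
qed (rule x0)

lemma Fr_Suc_le: "Fr i (x (Suc k)) \<le> Fr i (x k)"
proof -
  obtain a0 a where "\<forall>i. 0 < a0 i \<and> a0 i \<le> \<tau> * L i"
    "backtrack f g \<tau> (x k) a0 = Some a" "x (Suc k) = prox_step f g a (x k)"
    by (rule step_backtracked[of k])
  from backtracked_step(2)[OF \<tau> this(1) x_in_dom this(2,3)] show ?thesis .
qed

lemma Fr_antimono: "k \<le> n \<Longrightarrow> Fr i (x n) \<le> Fr i (x k)"
  by (rule lift_Suc_antimono_le[of "\<lambda>k. Fr i (x k)", OF Fr_Suc_le])

text \<open>With \<open>\<delta> = 0\<close> this is Fejer monotonicity; for general
  \<open>\<delta>\<close> it is the summand of the telescoping sum.\<close>

lemma gap_le_distance_decrease:
  assumes "z \<in> eff_dom" "0 \<le> \<delta>" "\<And>i. \<delta> * (\<tau> * L i) \<le> Fr i (x (Suc k)) - Fr i z"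
  shows "\<delta> \<le> 1 / 2 * (norm (z - x k))\<^sup>2 - 1 / 2 * (norm (z - x (Suc k)))\<^sup>2"
proof -
  obtain a0 a where "\<forall>i. 0 < a0 i \<and> a0 i \<le> \<tau> * L i"
    "backtrack f g \<tau> (x k) a0 = Some a" "x (Suc k) = prox_step f g a (x k)"
    by (rule step_backtracked[of k])
  from backtracked_step(3)[OF \<tau> this(1) x_in_dom this(2,3) assms]
  show ?thesis .
qed

text \<open>By monotonicity of the objectives, the gap at index \<open>n\<close> is present at all
  earlier iterates, so each of the first \<open>n\<close> steps lowers half the squared distance to
  \<open>z\<close> by at least \<open>\<delta>\<close>.\<close>

lemma gap_rate:
  assumes z: "z \<in> eff_dom" and \<delta>: "0 \<le> \<delta>" "\<And>i. \<delta> * (\<tau> * L i) \<le> Fr i (x n) - Fr i z"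
  shows "real n * \<delta> \<le> 1 / 2 * (norm (z - x 0))\<^sup>2"
proof -
  have "k \<le> n \<Longrightarrow> real k * \<delta> \<le> 1 / 2 * (norm (z - x 0))\<^sup>2 - 1 / 2 * (norm (z - x k))\<^sup>2" for k
  proof (induction k)
    case (Suc k)
    have "\<delta> * (\<tau> * L i) \<le> Fr i (x (Suc k)) - Fr i z" for i
      using \<delta>(2)[of i] Fr_antimono[OF Suc.prems, of i] by linarith
    from gap_le_distance_decrease[OF z \<delta>(1) this] Suc show ?case
      by (simp add: algebra_simps)
  qed simp
  from this[of n] zero_le_power2[of "norm (z - x n)"] show ?thesis by linarith
qed

definition \<Omega> :: "'a set" where
  "\<Omega> = {z \<in> eff_dom. \<forall>i. Fr i z \<le> Fr i (x 0)}"

lemma x_in_\<Omega>: "x k \<in> \<Omega>"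
  by (simp add: \<Omega>_def x_in_dom Fr_antimono)

lemma closed_\<Omega>: "closed \<Omega>"
  unfolding \<Omega>_def by (rule closed_Fr_sublevel)

text \<open>A point \<open>y\<close> violating the bound would dominate \<open>x n\<close>, hence
  lie in \<open>\<Omega>\<close>, and \<open>gap_rate\<close> with the distance bound
  \<open>R\<close> excludes this.\<close>

lemma merit_le:
  assumes F: "\<And>i y. F i y = ereal (f i y) + g i y"
    and R: "\<And>u. u \<in> \<Omega> \<Longrightarrow> norm (u - x 0) \<le> R" and n: "1 \<le> n"
  shows "merit (\<lambda>i. \<tau> * L i) F (x n) \<le> ereal (R\<^sup>2 / (2 * real n))"
  unfolding merit_def
proof (rule SUP_least)
  fix y
  let ?q = "\<lambda>i. (F i (x n) - F i y) / ereal (\<tau> * L i)"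
  show "(MIN i. ?q i) \<le> ereal (R\<^sup>2 / (2 * real n))"
  proof (rule ccontr)
    assume "\<not> ?thesis"
    then have "ereal (R\<^sup>2 / (2 * real n)) < (MIN i. ?q i)" by (simp only: not_le)
    \<comment> \<open>A real number in between, since the minimum is so far only known to be an
      extended real.\<close>
    then obtain \<delta> where less: "ereal (R\<^sup>2 / (2 * real n)) < ereal \<delta>" "ereal \<delta> < (MIN i. ?q i)"
      using ereal_dense2 by blast
    from less(2) have \<delta>: "R\<^sup>2 / (2 * real n) < \<delta>" "\<And>i. ereal \<delta> < ?q i"
      using less(1) by simp_all
    have \<delta>_nonneg: "0 \<le> \<delta>"
      using \<delta>(1) by (rule order_trans[OF _ less_imp_le, rotated]) simp
    have y: "y \<in> eff_dom"
    proof (rule ccontr)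
      assume "y \<notin> eff_dom"
      then obtain i where "g i y = \<infinity>" by (auto simp: eff_dom_def)
      then have "?q i = - \<infinity>"
        using \<tau>L_pos[of i] by (simp add: F F_eq_Fr x_in_dom del: ereal_times)
      then show False using \<delta>(2)[of i] by simp
    qed
    have le: "\<delta> * (\<tau> * L i) \<le> Fr i (x n) - Fr i y" for i
    proof -
      have "\<delta> < (Fr i (x n) - Fr i y) / (\<tau> * L i)"
        using \<delta>(2)[of i] \<tau> L_pos[of i] by (simp add: F F_eq_Fr x_in_dom y)
      then show ?thesis using \<tau>L_pos[of i] by (simp add: pos_less_divide_eq)
    qed
    have "Fr i y \<le> Fr i (x 0)" for i
      using le[of i] \<delta>_nonneg \<tau>L_pos[of i] Fr_antimono[of 0 n i] mult_nonneg_nonneg[of \<delta> "\<tau> * L i"] by linarith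
    then have "norm (y - x 0) \<le> R" using y R by (simp add: \<Omega>_def)
    then have "(norm (y - x 0))\<^sup>2 \<le> R\<^sup>2" by (simp add: power_mono)
    with gap_rate[OF y \<delta>_nonneg le] have "real n * \<delta> \<le> R\<^sup>2 / 2" by simp
    then have "\<delta> \<le> R\<^sup>2 / (2 * real n)" using n by (simp add: field_simps)
    with \<delta>(1) show False by simp
  qed
qed

text \<open>A strictly dominating \<open>y\<close> would leave the same positive gap at every
  iterate, so \<open>real n * \<delta>\<close> would be bounded in \<open>n\<close>.\<close>

lemma weakly_pareto_if_Fr_le:
  assumes F: "\<And>i y. F i y = ereal (f i y) + g i y"
    and xs: "xs \<in> eff_dom" "\<And>i n. Fr i xs \<le> Fr i (x n)"
  shows "weakly_pareto F xs"
  unfolding weakly_pareto_def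
proof (intro conjI notI)
  show "\<forall>i. F i xs < \<infinity>" unfolding F F_less_PInf_iff by (rule xs(1))
  assume "\<exists>y. \<forall>i. F i y < F i xs"
  then obtain y where less: "\<And>i. F i y < F i xs" by blast
  have "F i y < \<infinity>" for i
    using less[of i] by (rule less_le_trans) simp
  then have y: "y \<in> eff_dom" using F_less_PInf_iff[of y] by (simp add: F)
  \<comment> \<open>The smallest scaled gap; it is positive because there are finitely many
    indices.\<close>
  define \<delta> where "\<delta> = (MIN i. (Fr i xs - Fr i y) / (\<tau> * L i))"
  have "0 < (Fr i xs - Fr i y) / (\<tau> * L i)" for i
    using less[of i] \<tau>L_pos[of i] by (simp add: F F_eq_Fr xs y)
  then have \<delta>_pos: "0 < \<delta>" by (simp add: \<delta>_def)
  have "\<delta> * (\<tau> * L i) \<le> Fr i xs - Fr i y" for i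
  proof -
    have "\<delta> \<le> (Fr i xs - Fr i y) / (\<tau> * L i)" by (simp add: \<delta>_def)
    then show ?thesis using \<tau>L_pos[of i] by (simp add: pos_le_divide_eq)
  qed
  then have "\<delta> * (\<tau> * L i) \<le> Fr i (x n) - Fr i y" for i n
    using xs(2)[of i n] by (meson diff_right_mono order_trans)
  then have le: "real n * \<delta> \<le> 1 / 2 * (norm (y - x 0))\<^sup>2" for n
    using gap_rate[OF y] \<delta>_pos by simp
  obtain n where "1 / 2 * (norm (y - x 0))\<^sup>2 < real n * \<delta>"
    using reals_Archimedean3[OF \<delta>_pos] by blast
  with le[of n] show False by simp
qed

text \<open>Compactness gives a cluster point, closed sublevel sets put it below all iterates, and
  Fejer monotonicity with respect to it upgrades subsequential convergence to convergence.\<close>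

lemma convergent_to_minorant:
  assumes bounded: "bounded \<Omega>"
  obtains xs where "x \<longlonglongrightarrow> xs" "xs \<in> eff_dom" "\<And>i n. Fr i xs \<le> Fr i (x n)"
proof -
  have "compact \<Omega>" using bounded closed_\<Omega> by (simp add: compact_eq_bounded_closed)
  then obtain xs r where r: "strict_mono r" "(x \<circ> r) \<longlonglongrightarrow> xs"
    unfolding compact_def using x_in_\<Omega> by metis
  have mem: "xs \<in> {z \<in> eff_dom. \<forall>i. Fr i z \<le> Fr i (x n)}" for n
  proof (rule Lim_in_closed_set[OF closed_Fr_sublevel _ _ r(2)])
    show "\<forall>\<^sub>F k in sequentially. (x \<circ> r) k \<in> {z \<in> eff_dom. \<forall>i. Fr i z \<le> Fr i (x n)}"
      using eventually_ge_at_top[of n]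
    proof eventually_elim
      case (elim k)
      then have "n \<le> r k" using seq_suble[OF r(1), of k] by linarith
      then show ?case by (simp add: x_in_dom Fr_antimono)
    qed
  qed simp
  have step: "norm (xs - x (Suc k)) \<le> norm (xs - x k)" for k
  proof -
    have "0 \<le> 1 / 2 * (norm (xs - x k))\<^sup>2 - 1 / 2 * (norm (xs - x (Suc k)))\<^sup>2"
      by (rule gap_le_distance_decrease) (use mem in auto)
    then have "(norm (xs - x (Suc k)))\<^sup>2 \<le> (norm (xs - x k))\<^sup>2" by linarith
    then show ?thesis by (rule power2_le_imp_le) simp
  qed
  have mono: "norm (xs - x n) \<le> norm (xs - x k)" if "k \<le> n" for k n
    using step that by (rule lift_Suc_antimono_le[of "\<lambda>k. norm (xs - x k)"])
  have "x \<longlonglongrightarrow> xs"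
  proof (rule metric_LIMSEQ_I)
    fix e :: real
    assume "0 < e"
    \<comment> \<open>A single iterate within \<open>e\<close> suffices, as the distance to
      \<open>xs\<close> never increases afterwards.\<close>
    then obtain k where "dist (x (r k)) xs < e"
      using metric_LIMSEQ_D[OF r(2)] by (metis comp_apply order_refl)
    then have "dist (x n) xs < e" if "r k \<le> n" for n
      using mono[OF that] by (simp add: dist_norm norm_minus_commute)
    then show "\<exists>N. \<forall>n\<ge>N. dist (x n) xs < e" by blast
  qed
  then show thesis using mem by (intro that[of xs]) auto
qed

end

section \<open>Transfer to the extended-valued statement\<close>

theorem theorem4p5:
  fixes f :: "'m::finite \<Rightarrow> real ^ 'n \<Rightarrow> real"
    and g F :: "'m \<Rightarrow> real ^ 'n \<Rightarrow> ereal"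
    and L :: "'m \<Rightarrow> real"
    and \<tau> \<alpha>min \<alpha>max :: real
    and xm1 :: "real ^ 'n"
    and x :: "nat \<Rightarrow> real ^ 'n"
    and \<Omega> :: "(real ^ 'n) set"
  assumes F: "\<And>i y. F i y = ereal (f i y) + g i y"
    and f_C1: "\<And>i. continuous_on UNIV (grad (f i))"
    and f_smooth: "\<And>i. smooth_fun (L i) (f i)"
    and f_convex: "\<And>i. convex_on UNIV (f i)"
    and g_proper: "\<And>i. proper_fun (g i)"
    and g_convex: "\<And>i. convex_fun (g i)"
    and g_lsc: "\<And>i. lsc_fun (g i)"
    and x0_dom: "\<And>i. F i (x 0) < \<infinity>"
    and \<Omega>: "\<Omega> = {y. \<forall>i. F i y \<le> F i (x 0)}"
    and \<Omega>_bounded: "bounded \<Omega>"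
    and \<tau>: "\<tau> > 1"
    and \<alpha>min_pos: "0 < \<alpha>min"
    and \<alpha>min_less: "\<alpha>min < \<alpha>max"
    and \<alpha>min_le: "\<alpha>min \<le> (MIN i. L i)"
    and run: "abbpgmo f g \<tau> \<alpha>min \<alpha>max xm1 x"
    and noncritical: "\<And>k. \<not> pareto_critical F (x k)"
  shows "(\<exists>xs. x \<longlonglongrightarrow> xs \<and> weakly_pareto F xs) \<and>
    (\<exists>R. (\<exists>u\<in>\<Omega>. \<exists>v\<in>\<Omega>. R = norm (u - v)) \<and> (\<forall>u\<in>\<Omega>. \<forall>v\<in>\<Omega>. norm (u - v) \<le> R) \<and>
      (\<forall>k\<ge>1. merit (\<lambda>i. \<tau> * L i) F (x k) \<le> ereal (R\<^sup>2 / (2 * real k))))"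
proof -
  have L: "\<alpha>min \<le> L i" for i
    using \<alpha>min_le by simp
  interpret composite_problem f g L
  proof
    show "0 < L i" for i using L[of i] \<alpha>min_pos by linarith
  qed (fact f_smooth f_convex g_proper g_convex g_lsc)+
  have "x 0 \<in> eff_dom" using F_less_PInf_iff[of "x 0"] x0_dom by (simp add: F)
  then interpret S: abbpgmo_sequence f g L \<tau> \<alpha>min \<alpha>max xm1 x
    using \<tau> \<alpha>min_pos L run by unfold_locales
  have "y \<in> eff_dom" if "\<And>i. F i y \<le> F i (x 0)" for y
  proof -
    have "F i y < \<infinity>" for i
      using that[of i] x0_dom[of i] by (rule le_less_trans)
    then show ?thesis using F_less_PInf_iff[of y] by (simp add: F)
  qed
  \<comment> \<open>Finiteness at \<open>x 0\<close> confines the level set to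
    \<open>eff_dom\<close>, where real and extended values agree.\<close>
  then have "\<Omega> = {y \<in> eff_dom. \<forall>i. F i y \<le> F i (x 0)}"
    unfolding \<Omega> by blast
  also have "\<dots> = S.\<Omega>"
    by (auto simp: S.\<Omega>_def F F_eq_Fr S.x_in_dom)
  finally have \<Omega>_eq: "\<Omega> = S.\<Omega>" .
  have "\<exists>xs. x \<longlonglongrightarrow> xs \<and> weakly_pareto F xs"
    using S.convergent_to_minorant S.weakly_pareto_if_Fr_le[OF F] \<Omega>_bounded by (metis \<Omega>_eq)
  moreover have "\<exists>R. (\<exists>u\<in>\<Omega>. \<exists>v\<in>\<Omega>. R = norm (u - v)) \<and> (\<forall>u\<in>\<Omega>. \<forall>v\<in>\<Omega>. norm (u - v) \<le> R) \<and>
      (\<forall>k\<ge>1. merit (\<lambda>i. \<tau> * L i) F (x k) \<le> ereal (R\<^sup>2 / (2 * real k)))"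
  proof (intro exI conjI)
    \<comment> \<open>The witness for \<open>R\<close> is the diameter, a maximum by
      compactness.\<close>
    have "compact \<Omega>"
      using \<Omega>_bounded S.closed_\<Omega> by (simp add: compact_eq_bounded_closed \<Omega>_eq)
    then show "\<exists>u\<in>\<Omega>. \<exists>v\<in>\<Omega>. diameter \<Omega> = norm (u - v)"
      using diameter_compact_attained[of \<Omega>] S.x_in_\<Omega> unfolding \<Omega>_eq dist_norm by (metis empty_iff)
    show R: "\<forall>u\<in>\<Omega>. \<forall>v\<in>\<Omega>. norm (u - v) \<le> diameter \<Omega>"
      using diameter_bounded_bound[OF \<Omega>_bounded] by (simp add: dist_norm)
    \<comment> \<open>The distance bound of \<open>S.merit_le\<close> is the case
      \<open>v = x 0\<close> of \<open>R\<close>.\<close>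
    show "\<forall>k\<ge>1. merit (\<lambda>i. \<tau> * L i) F (x k) \<le> ereal ((diameter \<Omega>)\<^sup>2 / (2 * real k))"
      using S.merit_le[OF F] R S.x_in_\<Omega> by (simp add: \<Omega>_eq)
  qed
  ultimately show ?thesis ..
qed

end
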